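(* Let $f:\mathbb{R}\to(-\infty,\infty]$ be proper and lower semicontinuous. Let $\bar{x}$ be a stationary point of $f$ (i.e. $0\in\partial f(\bar x)$). Suppose that there exists an interval $(a,b)\subseteq\operatorname{int}\operatorname{dom} f$ containing $\bar x$, where $-\infty\leq a<b\leq\infty$, such that $f$ is convex on $(a,b)$ and $C^1$ on $(a,b)\setminus\{\bar{x}\}$. Set $\eta=\min\{f(a)-f(\bar{x}),f(b)-f(\bar{x})\}$, where $f(x)$ is set to be $\infty$ if $x=\pm\infty$, and assume $\eta>0$. Let $f_1(x)=f(x+\bar{x})-f(\bar{x})$ for $x\in(a-\bar{x},0]$ and $f_2(x)=f(x+\bar{x})-f(\bar{x})$ for $x\in[0,b-\bar{x})$. Furthermore, define $\tilde{\varphi}:[0,\eta)\to[0,\infty)$ by $$\tilde\varphi(t)=\int_0^t\max\big\{(-f_1^{-1})'(s),(f_2^{-1})'(s)\big\}\,ds\quad\text{for all } t\in(0,\eta),$$ and $\tilde{\varphi}(0)=0$, where $f_i^{-1}$ is the inverse function of $f_i$, and $(f_i^{-1})'$ is set to be identically $0$ if $f_i^{-1}$ does not exist. Then $\tilde{\varphi}$ is the exact modulus of the generalized concave KL property of $f$ at $\bar{x}$ with respect to $U=(a,b)$ and $\eta$.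
   Context: $\partial f$ is the limiting subdifferential: for $x\in\operatorname{dom} f$, $v\in\hat\partial f(x)$ if $f(y)\ge f(x)+v(y-x)+o(|y-x|)$ for every $y\in\operatorname{dom} f$, and $v\in\partial f(x)$ if there are $x_k\to x$ with $f(x_k)\to f(x)$ and $v_k\in\hat\partial f(x_k)$ with $v_k\to v$. $\operatorname{dom}\partial f=\{x:\partial f(x)\neq\emptyset\}$. $\operatorname{dist}(0,K)=\inf\{|y|:y\in K\}$ and $\operatorname{dist}^{-1}(0,K)=1/\operatorname{dist}(0,K)$. Exact modulus: for $\bar x\in\operatorname{dom}\partial f$, a neighborhood $U\subseteq\operatorname{dom}\partial f$ of $\bar x$ and $\eta\in(0,\infty]$, define $h$ on $(0,\eta)$ by $$h(s)=\sup\big\{\operatorname{dist}^{-1}\big(0,\partial f(x)\big): x\in U,\ 0<f(x)-f(\bar{x})<\eta,\ s\leq f(x)-f(\bar{x})\big\}.$$ Suppose that $h(s)<\infty$ for $s\in(0,\eta)$. The exact modulus of the generalized concave KL property of $f$ at $\bar x$ with respect to $U$ and $\eta$ is the function from $[0,\eta)$ to $[0,\infty)$ given by $t\mapsto\int_0^t h(s)\,ds$ for $t\in(0,\eta)$ and with value $0$ at $0$. If there is no $x\in U$ with $0<f(x)-f(\bar x)<\eta$, the exact modulus with respect to $U$ and $\eta$ is set to be identically $0$.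
   Formalization: The inverse of f_i is taken only over values in (0,η): it exists if each such value has exactly one preimage. With injectivity of f_i on its whole domain the claim fails, e.g. f(x)=max(0,|x|-1)^2 at 0 on R, where φ̃ would be 0 but the exact modulus is √t. *)

theory Defs
  imports "HOL-Analysis.Analysis" "HOL-Library.Landau_Symbols"
begin

definition edom :: "(real \<Rightarrow> ereal) \<Rightarrow> real set" where
  "edom f = {x. f x < \<infinity>}"

definition proper_fun :: "(real \<Rightarrow> ereal) \<Rightarrow> bool" where
  "proper_fun f \<longleftrightarrow> (\<forall>x. f x \<noteq> -\<infinity>) \<and> edom f \<noteq> {}"

definition lower_semicont :: "(real \<Rightarrow> ereal) \<Rightarrow> bool" where
  "lower_semicont f \<longleftrightarrow> (\<forall>x. f x \<le> Liminf (at x) f)"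

definition frechet_subdiff :: "(real \<Rightarrow> ereal) \<Rightarrow> real \<Rightarrow> real set" where
  "frechet_subdiff f x =
     {v. x \<in> edom f \<and>
         (\<exists>r :: real \<Rightarrow> real. r \<in> o[at x](\<lambda>y. \<bar>y - x\<bar>) \<and>
            (\<forall>y\<in>edom f. f y \<ge> f x + ereal (v * (y - x)) + ereal (r y)))}"

definition limiting_subdiff :: "(real \<Rightarrow> ereal) \<Rightarrow> real \<Rightarrow> real set" where
  "limiting_subdiff f x =
     {v. x \<in> edom f \<and>
         (\<exists>xs vs. xs \<longlonglongrightarrow> x \<and> (\<lambda>k. f (xs k)) \<longlonglongrightarrow> f x \<and>
            (\<forall>k. vs k \<in> frechet_subdiff f (xs k)) \<and> vs \<longlonglongrightarrow> v)}"

definition dom_subdiff :: "(real \<Rightarrow> ereal) \<Rightarrow> real set" where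
  "dom_subdiff f = {x. limiting_subdiff f x \<noteq> {}}"

text \<open>Distances and their reciprocals are taken in \<^typ>\<open>ennreal\<close>, where
  \<open>1 / 0 = \<infinity>\<close> and suprema over the empty set are \<open>0\<close>.\<close>

definition dist_zero :: "real set \<Rightarrow> ennreal" where
  "dist_zero K = (INF y\<in>K. ennreal \<bar>y\<bar>)"

definition KL_slope_sup ::
  "(real \<Rightarrow> ereal) \<Rightarrow> real \<Rightarrow> real set \<Rightarrow> ereal \<Rightarrow> real \<Rightarrow> ennreal" where
  "KL_slope_sup f xbar U \<eta> s =
     (SUP x\<in>{x\<in>U. 0 < f x - f xbar \<and> f x - f xbar < \<eta> \<and> ereal s \<le> f x - f xbar}.
        1 / dist_zero (limiting_subdiff f x))"

text \<open>Only the values of \<open>\<phi>\<close> on \<open>[0, \<eta>)\<close> are constrained. The side conditions under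
  which the exact modulus is defined, and the finiteness of its values, are part of the
  predicate.\<close>

definition is_exact_modulus ::
  "(real \<Rightarrow> ereal) \<Rightarrow> real \<Rightarrow> real set \<Rightarrow> ereal \<Rightarrow> (real \<Rightarrow> real) \<Rightarrow> bool" where
  "is_exact_modulus f xbar U \<eta> \<phi> \<longleftrightarrow>
     xbar \<in> dom_subdiff f \<and> xbar \<in> interior U \<and> U \<subseteq> dom_subdiff f \<and> 0 < \<eta> \<and>
     (\<forall>s. 0 < s \<and> ereal s < \<eta> \<longrightarrow> KL_slope_sup f xbar U \<eta> s < \<infinity>) \<and>
     \<phi> 0 = 0 \<and>
     (if \<exists>x\<in>U. 0 < f x - f xbar \<and> f x - f xbar < \<eta>
      then \<forall>t. 0 < t \<and> ereal t < \<eta> \<longrightarrow>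
             0 \<le> \<phi> t \<and>
             ennreal (\<phi> t) = (\<integral>\<^sup>+ s\<in>{0<..<t}. KL_slope_sup f xbar U \<eta> s \<partial>lborel)
      else \<forall>t. 0 < t \<and> ereal t < \<eta> \<longrightarrow> \<phi> t = 0)"

definition at_ext :: "(real \<Rightarrow> ereal) \<Rightarrow> ereal \<Rightarrow> ereal" where
  "at_ext f z = (if \<bar>z\<bar> = \<infinity> then \<infinity> else f (real_of_ereal z))"

text \<open>The inverse of \<open>g\<close> (with domain \<open>D\<close>) as a function on a set \<open>S\<close> of values: it exists
  iff every value in \<open>S\<close> has exactly one preimage in \<open>D\<close>. Below \<open>S = (0, \<eta>)\<close>, so \<open>g\<close> may
  vanish on a nondegenerate interval and still have an inverse on \<open>S\<close>. Asking for injectivity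
  on all of \<open>D\<close> instead would be too strong: for \<open>f x = (max 0 (\<bar>x\<bar> - 1))\<^sup>2\<close> at \<open>0\<close> the exact
  modulus is \<open>sqrt t\<close>, although \<open>f\<close> is not injective on either side of \<open>0\<close>.\<close>

definition has_inverse_on :: "real set \<Rightarrow> real set \<Rightarrow> (real \<Rightarrow> real) \<Rightarrow> bool" where
  "has_inverse_on S D g \<longleftrightarrow> bij_betw g {x\<in>D. g x \<in> S} S"

definition inverse_on :: "real set \<Rightarrow> real set \<Rightarrow> (real \<Rightarrow> real) \<Rightarrow> real \<Rightarrow> real" where
  "inverse_on S D g = the_inv_into {x\<in>D. g x \<in> S} g"

end

theory Submission
  imports Defs
begin

text \<open>
  Convexity turns the supremum in the exact modulus into a value at a single level. On the
  interval \<open>(a, b)\<close> every limiting subgradient of \<open>f\<close> is a global affine support there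
  (\<open>limiting_subdiff_global\<close>), so at a point \<open>x \<noteq> xbar\<close> the subdifferential is
  \<open>{f' x}\<close> and the supremum defining \<open>h s\<close> ranges over \<open>1 / \<bar>f' x\<bar>\<close> for the points with
  \<open>s \<le> f x - f xbar < \<eta>\<close>. To the right of \<open>xbar\<close>, and symmetrically to the left, the
  derivative grows with the level once \<open>f\<close> exceeds \<open>f xbar\<close>; hence on a side where that happens the
  supremum is attained at level \<open>s\<close>, where \<open>1 / \<bar>f' x\<bar>\<close> is the derivative of the inverse of
  that branch. So \<open>h\<close> is the maximum of the two inverse derivatives.

  Both branches are handled by one locale, \<open>convex_branch\<close>, which describes a branch reflected
  so that it starts at \<open>0\<close> and runs to the right; the left branch of \<open>f\<close> enters it through the
  reflection lemmas for \<open>inverse_on\<close>. Two points need care.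

  A branch that ever exceeds \<open>f xbar\<close> must take all values in \<open>(0, \<eta>)\<close>, for otherwise its
  inverse on that set would not exist and its slopes would be lost. At a finite
  endpoint this is lower semicontinuity together with the choice of \<open>\<eta>\<close>
  (\<open>lower_semicont_exceeds\<close>); at an infinite endpoint it is the linear growth of a tangent line
  (\<open>reach_on_unbounded_ray\<close>). A branch that never exceeds \<open>f xbar\<close> contributes the
  empty supremum \<open>0\<close>, in agreement with the convention for a missing inverse.

  The Bochner integral in the definition of \<open>\<phi>\<close> agrees with the integral of \<open>h\<close> only if
  the integrand is integrable near \<open>0\<close>, where the inverse derivatives may be unbounded. They are
  nonnegative derivatives of increasing functions bounded below, so the fundamental theorem of
  calculus for nonnegative integrands gives integrability (\<open>inv_slope_integrable\<close>).
\<close>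

section \<open>Inverse functions and reflection\<close>

lemma inverse_on_cong:
  assumes "\<And>x. x \<in> D \<Longrightarrow> g x = h x"
  shows "has_inverse_on S D g = has_inverse_on S D h" and "inverse_on S D g = inverse_on S D h"
proof -
  have eq: "{x \<in> D. g x \<in> S} = {x \<in> D. h x \<in> S}"
    using assms by auto
  show "has_inverse_on S D g = has_inverse_on S D h"
    unfolding has_inverse_on_def eq by (rule bij_betw_cong) (use assms in auto)
  show "inverse_on S D g = inverse_on S D h"
    unfolding inverse_on_def the_inv_into_def eq
    by (intro ext arg_cong[where f = The]) (use assms in auto)
qed

lemma has_inverse_on_reflect:
  "has_inverse_on S (uminus ` D) (\<lambda>y. g (- y)) \<longleftrightarrow> has_inverse_on S D g"
proof -
  have "{y \<in> uminus ` D. g (- y) \<in> S} = uminus ` {x \<in> D. g x \<in> S}"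
    by auto
  then show ?thesis
    by (simp add: has_inverse_on_def bij_betw_def inj_on_def image_image)
qed

lemma inverse_on_reflect:
  assumes inv: "has_inverse_on S D g" and u: "u \<in> S"
  shows "inverse_on S (uminus ` D) (\<lambda>y. g (- y)) u = - inverse_on S D g u"
proof -
  have bij: "bij_betw g {x \<in> D. g x \<in> S} S"
    and bij': "bij_betw (\<lambda>y. g (- y)) {y \<in> uminus ` D. g (- y) \<in> S} S"
    using inv has_inverse_on_reflect[of S D g] by (auto simp: has_inverse_on_def)
  have "g (inverse_on S D g u) = u" and "inverse_on S D g u \<in> D"
    using bij u the_inv_into_into[of g "{x \<in> D. g x \<in> S}" u "{x \<in> D. g x \<in> S}"]
    by (auto simp: inverse_on_def f_the_inv_into_f_bij_betw bij_betw_def)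
  then show ?thesis
    using bij' u unfolding inverse_on_def[of S "uminus ` D"]
    by (intro the_inv_into_f_eq) (auto simp: bij_betw_def)
qed

text \<open>The two sign changes, of the argument and of the inverse, cancel: this is why the modulus
  contains \<open>(- f1\<inverse>)'\<close> rather than \<open>(f1\<inverse>)'\<close>.\<close>

lemma deriv_inverse_on_reflect:
  assumes S: "open S" "s \<in> S" and inv: "has_inverse_on S D g"
  shows "deriv (\<lambda>u. - inverse_on S (uminus ` D) (\<lambda>y. g (- y)) u) s = deriv (inverse_on S D g) s"
proof (rule deriv_cong_ev)
  show "eventually (\<lambda>u. - inverse_on S (uminus ` D) (\<lambda>y. g (- y)) u = inverse_on S D g u) (nhds s)"
    using eventually_nhds_in_open[OF S]
    by eventually_elim (simp add: inverse_on_reflect[OF inv])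
qed simp

section \<open>Subdifferentials of functions convex on an open interval\<close>

text \<open>The Frechet inequality is only local, but along the segment towards \<open>y\<close> convexity bounds
  \<open>g\<close> above by the chord. At the point \<open>x + t (y - x)\<close> the error term is at most \<open>t e\<close> for
  small \<open>t\<close>, and dividing by \<open>t\<close> leaves the global inequality up to \<open>e\<close>.\<close>

lemma frechet_subdiff_global:
  fixes f :: "real \<Rightarrow> ereal" and g :: "real \<Rightarrow> real"
  assumes conv: "convex_on I g" and fin: "\<And>z. z \<in> I \<Longrightarrow> f z = ereal (g z)"
    and x: "x \<in> I" and y: "y \<in> I" and v: "v \<in> frechet_subdiff f x"
  shows "g x + v * (y - x) \<le> g y"
proof (cases "y = x")
  case False
  from v obtain r where r: "r \<in> o[at x](\<lambda>y. \<bar>y - x\<bar>)"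
    and ineq: "\<And>z. z \<in> edom f \<Longrightarrow> f x + ereal (v * (z - x)) + ereal (r z) \<le> f z"
    by (auto simp: frechet_subdiff_def)
  have "g x + v * (y - x) \<le> g y + e" if e: "0 < e" for e
  proof -
    have "0 < e / \<bar>y - x\<bar>"
      using e False by simp
    from landau_o.smallD[OF r this] obtain d where d: "0 < d"
      and small: "\<And>z. z \<noteq> x \<Longrightarrow> dist z x < d \<Longrightarrow> \<bar>r z\<bar> \<le> e / \<bar>y - x\<bar> * \<bar>z - x\<bar>"
      by (auto simp: eventually_at)
    \<comment> \<open>Any \<open>t < 1\<close> with \<open>t \<bar>y - x\<bar> < d\<close> would do.\<close>
    define t where "t = min (1/2) (d / (2 * \<bar>y - x\<bar>))"
    define z where "z = x + t * (y - x)"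
    have t: "0 < t" "t < 1"
      using d False by (auto simp: t_def)
    have "t * \<bar>y - x\<bar> \<le> d / (2 * \<bar>y - x\<bar>) * \<bar>y - x\<bar>"
      by (rule mult_right_mono) (auto simp: t_def)
    also have "\<dots> < d"
      using d False by simp
    finally have "dist z x < d"
      using t by (simp add: z_def dist_real_def abs_mult)
    moreover have "z \<noteq> x"
      using t False by (simp add: z_def)
    ultimately have "\<bar>r z\<bar> \<le> e / \<bar>y - x\<bar> * \<bar>z - x\<bar>"
      by (intro small)
    also have "\<dots> = t * e"
      using t False by (simp add: z_def abs_mult)
    finally have rz: "- (t * e) \<le> r z"
      by linarith
    have z_comb: "z = (1 - t) *\<^sub>R x + t *\<^sub>R y"
      by (simp add: z_def algebra_simps)
    have zI: "z \<in> I"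
      unfolding z_comb using convex_on_imp_convex[OF conv] x y t by (intro convexD) auto
    have "g z \<le> (1 - t) * g x + t * g y"
      unfolding z_comb using conv x y t by (intro convex_onD) auto
    moreover have "g x + v * (z - x) + r z \<le> g z"
      using ineq[of z] fin[OF zI] fin[OF x] by (auto simp: edom_def)
    moreover have "v * (z - x) = t * (v * (y - x))"
      by (simp add: z_def)
    ultimately have "g x + t * (v * (y - x)) - t * e \<le> (1 - t) * g x + t * g y"
      using rz by linarith
    then have "t * (g x + v * (y - x)) \<le> t * (g y + e)"
      by (simp add: algebra_simps)
    then show ?thesis
      using t by simp
  qed
  then show ?thesis
    by (rule field_le_epsilon)
qed simp

text \<open>Support inequalities are closed conditions, and a convex function is continuous on an open
  set, so they survive the limit that defines the limiting subdifferential.\<close>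

lemma limiting_subdiff_global:
  fixes f :: "real \<Rightarrow> ereal" and g :: "real \<Rightarrow> real"
  assumes I: "open I" and conv: "convex_on I g" and fin: "\<And>z. z \<in> I \<Longrightarrow> f z = ereal (g z)"
    and x: "x \<in> I" and y: "y \<in> I" and v: "v \<in> limiting_subdiff f x"
  shows "g x + v * (y - x) \<le> g y"
proof -
  from v obtain xs vs where xs: "xs \<longlonglongrightarrow> x" and vs: "vs \<longlonglongrightarrow> v"
    and sub: "\<And>k. vs k \<in> frechet_subdiff f (xs k)"
    by (auto simp: limiting_subdiff_def)
  have ev: "eventually (\<lambda>k. xs k \<in> I) sequentially"
    using xs I x by (rule topological_tendstoD)
  have "isCont g x"
    using convex_on_continuous[OF I conv] I x by (simp add: continuous_on_eq_continuous_at)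
  then have "(\<lambda>k. g (xs k)) \<longlonglongrightarrow> g x"
    using xs by (rule isCont_tendsto_compose)
  then have "(\<lambda>k. g (xs k) + vs k * (y - xs k)) \<longlonglongrightarrow> g x + v * (y - x)"
    by (intro tendsto_intros xs vs)
  moreover have "eventually (\<lambda>k. g (xs k) + vs k * (y - xs k) \<le> g y) sequentially"
    using ev by eventually_elim (rule frechet_subdiff_global[OF conv fin _ y sub])
  ultimately show ?thesis
    by (rule tendsto_upperbound) simp
qed

text \<open>The constant sequence \<open>x\<close> serves as witness, since the first-order Taylor remainder turns
  \<open>m\<close> into a Frechet subgradient.\<close>

lemma deriv_in_limiting_subdiff:
  fixes f :: "real \<Rightarrow> ereal"
  assumes proper: "\<And>z. f z \<noteq> - \<infinity>" and x: "x \<in> edom f"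
    and deriv: "((\<lambda>z. real_of_ereal (f z)) has_real_derivative m) (at x)"
  shows "m \<in> limiting_subdiff f x"
proof -
  define g where "g = (\<lambda>z. real_of_ereal (f z))"
  have fin: "f z = ereal (g z)" if "z \<in> edom f" for z
    using that proper[of z] by (cases "f z") (auto simp: edom_def g_def)
  define r where "r z = g z - g x - m * (z - x)" for z
  have "r \<in> o[at x](\<lambda>z. \<bar>z - x\<bar>)"
  proof (rule landau_o.smallI)
    fix c :: real assume c: "0 < c"
    have "((\<lambda>z. (g z - g x) / (z - x)) \<longlongrightarrow> m) (at x)"
      using deriv by (simp add: has_field_derivative_iff g_def)
    then have "eventually (\<lambda>z. dist ((g z - g x) / (z - x)) m < c) (at x)"
      using c by (rule tendstoD)
    then show "eventually (\<lambda>z. norm (r z) \<le> c * norm \<bar>z - x\<bar>) (at x)"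
      using eventually_neq_at_within[of x x]
    proof eventually_elim
      case (elim z)
      have "r z = ((g z - g x) / (z - x) - m) * (z - x)"
        using elim(2) by (simp add: r_def field_simps)
      then have "\<bar>r z\<bar> = \<bar>(g z - g x) / (z - x) - m\<bar> * \<bar>z - x\<bar>"
        by (simp add: abs_mult)
      also have "\<dots> \<le> c * \<bar>z - x\<bar>"
        using elim(1) by (intro mult_right_mono) (auto simp: dist_real_def)
      finally show ?case by simp
    qed
  qed
  moreover have "f x + ereal (m * (z - x)) + ereal (r z) \<le> f z" if "z \<in> edom f" for z
    using fin[OF that] fin[OF x] by (simp add: r_def)
  ultimately have "m \<in> frechet_subdiff f x"
    using x by (auto simp: frechet_subdiff_def)
  then have "\<exists>xs vs. xs \<longlonglongrightarrow> x \<and> (\<lambda>k. f (xs k)) \<longlonglongrightarrow> f x \<and>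
      (\<forall>k::nat. vs k \<in> frechet_subdiff f (xs k)) \<and> vs \<longlonglongrightarrow> m"
    by (intro exI[of _ "\<lambda>_. x"] exI[of _ "\<lambda>_. m"]) simp
  with x show ?thesis
    by (simp add: limiting_subdiff_def)
qed

text \<open>If \<open>v\<close> supports \<open>g\<close> at \<open>x\<close>, then \<open>x\<close> minimises \<open>y \<mapsto> g y - v y\<close>, whose derivative
  \<open>m - v\<close> must therefore vanish.\<close>

lemma limiting_subdiff_eq_deriv:
  fixes f :: "real \<Rightarrow> ereal"
  assumes proper: "\<And>z. f z \<noteq> - \<infinity>" and I: "open I" "I \<subseteq> edom f"
    and conv: "convex_on I (\<lambda>z. real_of_ereal (f z))" and x: "x \<in> I"
    and deriv: "((\<lambda>z. real_of_ereal (f z)) has_real_derivative m) (at x)"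
  shows "limiting_subdiff f x = {m}"
proof -
  define g where "g = (\<lambda>z. real_of_ereal (f z))"
  have fin: "f z = ereal (g z)" if "z \<in> I" for z
    using that I(2) proper[of z] by (cases "f z") (auto simp: edom_def g_def)
  have "v = m" if v: "v \<in> limiting_subdiff f x" for v
  proof -
    obtain d where d: "0 < d" "\<And>y. \<bar>x - y\<bar> < d \<Longrightarrow> y \<in> I"
      using I(1) x unfolding open_dist dist_real_def by (metis abs_minus_commute)
    have "((\<lambda>y. g y - v * y) has_real_derivative m - v) (at x)"
      using deriv by (auto simp: g_def intro!: derivative_eq_intros)
    moreover have "g x - v * x \<le> g y - v * y" if "\<bar>x - y\<bar> < d" for y
      using limiting_subdiff_global[OF I(1) conv fin[unfolded g_def] x d(2)[OF that] v]
      by (simp add: g_def algebra_simps)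
    ultimately have "m - v = 0"
      using DERIV_local_min[OF _ d(1)] by blast
    then show ?thesis by simp
  qed
  moreover have "m \<in> limiting_subdiff f x"
    using I(2) x by (intro deriv_in_limiting_subdiff[OF proper _ deriv]) blast
  ultimately show ?thesis by blast
qed

section \<open>One branch of a convex function\<close>

text \<open>
  The branch is \<open>p\<close> on the interval \<open>D\<close> with left endpoint \<open>0\<close>, and \<open>q\<close> is its derivative
  off \<open>0\<close>. Convexity enters only through the tangent inequality. The last assumption says that
  a branch with some positive value climbs to every level below \<open>\<eta>\<close>. A
  branch may be flat before it starts to rise, so only positive values have unique preimages.
\<close>

locale convex_branch =
  fixes p q :: "real \<Rightarrow> real" and D :: "real set" and \<eta> :: ereal
  assumes interval: "is_interval D" and zero_mem: "0 \<in> D" and nonneg: "x \<in> D \<Longrightarrow> 0 \<le> x"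
    and open_pos: "open (D - {0})" and at_zero: "p 0 = 0" and cont: "continuous_on D p"
    and cont_deriv: "continuous_on (D - {0}) q"
    and deriv: "x \<in> D - {0} \<Longrightarrow> (p has_real_derivative q x) (at x)"
    and tangent: "x \<in> D - {0} \<Longrightarrow> y \<in> D \<Longrightarrow> p x + q x * (y - x) \<le> p y"
    and reach: "x \<in> D \<Longrightarrow> 0 < p x \<Longrightarrow> 0 < s \<Longrightarrow> ereal s < \<eta> \<Longrightarrow> \<exists>y\<in>D. s \<le> p y"
begin

abbreviation (input) levels where "levels \<equiv> einterval 0 \<eta>"
abbreviation (input) level_part where "level_part \<equiv> {x \<in> D. p x \<in> einterval 0 \<eta>}"

definition branch_inv where "branch_inv = inverse_on levels D p"

text \<open>The summand of the modulus contributed by this branch, with the value \<open>0\<close> when there is no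
  inverse.\<close>

definition inv_slope where
  "inv_slope s = (if has_inverse_on levels D p then deriv branch_inv s else 0)"

lemma level_part_D: "x \<in> level_part \<Longrightarrow> x \<in> D - {0}"
  and level_part_gt: "x \<in> level_part \<Longrightarrow> 0 < p x"
  using at_zero by (auto simp: einterval_iff)

lemma pos_point: assumes "x \<in> D" "0 < p x" shows "0 < x" "x \<in> D - {0}"
  using nonneg[OF assms(1)] assms at_zero by (auto simp: less_le)

text \<open>The tangent at a point of positive height lies at or below the branch at its origin,
  so it has to rise from there.\<close>

lemma slope_pos:
  assumes "x \<in> D" "0 < p x" shows "0 < q x"
proof -
  have "p x \<le> q x * x"
    using tangent[OF pos_point(2)[OF assms] zero_mem] at_zero by simp
  with assms(2) pos_point(1)[OF assms] show ?thesis
    by (metis less_le_trans zero_less_mult_pos2)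
qed

lemma strict_mono_pos:
  assumes "x \<in> D" "0 < p x" "y \<in> D" "x < y" shows "p x < p y"
proof -
  have "0 < q x * (y - x)"
    using slope_pos assms by simp
  then show ?thesis
    using tangent[OF pos_point(2)[OF assms(1,2)] assms(3)] by linarith
qed

text \<open>Adding the tangent inequalities at \<open>x\<close> and at \<open>y\<close> gives monotonicity of the derivative.\<close>

lemma slope_mono:
  assumes "x \<in> D" "0 < p x" "y \<in> D" "x \<le> y" shows "q x \<le> q y"
proof (cases "x = y")
  case False
  then have less: "x < y" using assms by simp
  have "y \<in> D - {0}"
    using less pos_point[OF assms(1,2)] assms(3) by auto
  then have "p y + q y * (x - y) \<le> p x"
    using tangent assms(1) by blast
  moreover have "p x + q x * (y - x) \<le> p y"
    using tangent[OF pos_point(2)[OF assms(1,2)] assms(3)] .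
  ultimately have "(q x - q y) * (y - x) \<le> 0"
    by (simp add: algebra_simps)
  with less show ?thesis
    by (simp add: mult_le_0_iff)
qed simp

text \<open>Injectivity comes from strict monotonicity at positive heights, surjectivity onto \<open>(0, \<eta>)\<close>
  from the intermediate value theorem.\<close>

lemma has_inverseI:
  assumes x0: "x0 \<in> D" "0 < p x0"
  shows "has_inverse_on levels D p"
proof -
  have "inj_on p level_part"
  proof (rule linorder_inj_onI')
    fix x y assume "x \<in> level_part" "y \<in> level_part" "x < y"
    then show "p x \<noteq> p y"
      using strict_mono_pos[of x y] level_part_gt[of x] by auto
  qed
  moreover have "s \<in> p ` level_part" if s: "s \<in> levels" for s
  proof -
    obtain y where y: "y \<in> D" "s \<le> p y"
      using reach[OF x0, of s] s by (auto simp: einterval_iff zero_ereal_def)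
    have sub: "{0..y} \<subseteq> D"
      using mem_is_interval_1_I[OF interval zero_mem y(1)] by auto
    have "\<exists>x\<ge>0. x \<le> y \<and> p x = s"
      using y s nonneg[OF y(1)] at_zero continuous_on_subset[OF cont sub]
      by (intro IVT') (auto simp: einterval_iff)
    then obtain x where "0 \<le> x" "x \<le> y" "p x = s" by blast
    then show ?thesis
      using sub s by auto
  qed
  ultimately show ?thesis
    by (auto simp: has_inverse_on_def bij_betw_def)
qed

context
  assumes invertible: "has_inverse_on levels D p"
begin

lemma branch_inv_props:
  assumes "s \<in> levels"
  shows "p (branch_inv s) = s" "branch_inv s \<in> D" "0 < branch_inv s" "branch_inv s \<in> D - {0}"
proof -
  have bij: "bij_betw p level_part levels"
    using invertible by (simp add: has_inverse_on_def)
  show 1: "p (branch_inv s) = s"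
    using f_the_inv_into_f_bij_betw[OF bij] assms by (simp add: branch_inv_def inverse_on_def)
  have "branch_inv s \<in> level_part"
    using the_inv_into_into[of p level_part s level_part] bij assms
    by (auto simp: branch_inv_def inverse_on_def bij_betw_def)
  then show 2: "branch_inv s \<in> D" by simp
  show "0 < branch_inv s" "branch_inv s \<in> D - {0}"
    using pos_point[OF 2] 1 assms by (auto simp: einterval_iff)
qed

lemma branch_inv_p: "x \<in> level_part \<Longrightarrow> branch_inv (p x) = x"
  using invertible by (auto simp: branch_inv_def inverse_on_def has_inverse_on_def bij_betw_def
      intro!: the_inv_into_f_eq)

lemma DERIV_branch_inv:
  assumes s: "s \<in> levels"
  shows "(branch_inv has_real_derivative 1 / q (branch_inv s)) (at s)"
proof -
  note i = branch_inv_props[OF s]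
  have cont': "continuous_on (D - {0}) p"
    using cont by (rule continuous_on_subset) auto
  have level_part_eq: "level_part = (D - {0}) \<inter> p -` levels"
    using level_part_D by auto
  have "open level_part"
    unfolding level_part_eq using cont' open_pos by (intro continuous_open_preimage) auto
  moreover have "continuous_on level_part p"
    using cont by (rule continuous_on_subset) auto
  moreover have "branch_inv s \<in> level_part" "0 < q (branch_inv s)"
    using i s slope_pos[OF i(2)] by (auto simp: einterval_iff)
  moreover have "(p has_derivative (*) (q (branch_inv s))) (at (branch_inv s))"
    using deriv[OF i(4)] by (simp add: has_field_derivative_def)
  ultimately have "(branch_inv has_derivative (*) (1 / q (branch_inv s))) (at (p (branch_inv s)))"
    using branch_inv_p
    by (intro has_derivative_inverse_strong[where f = p and f' = "(*) (q (branch_inv s))" and S = level_part])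
      (simp_all add: fun_eq_iff)
  then show ?thesis
    using i(1) by (simp add: has_field_derivative_def)
qed

lemma inv_slope_eq: "s \<in> levels \<Longrightarrow> inv_slope s = 1 / q (branch_inv s)"
  using invertible DERIV_imp_deriv[OF DERIV_branch_inv] by (simp add: inv_slope_def)

lemma branch_inv_mono:
  assumes "s \<in> levels" "t \<in> levels" "s \<le> t" shows "branch_inv s \<le> branch_inv t"
proof (rule ccontr)
  assume "\<not> branch_inv s \<le> branch_inv t"
  then have "p (branch_inv t) < p (branch_inv s)"
    using branch_inv_props assms by (intro strict_mono_pos) (auto simp: einterval_iff)
  then show False
    using branch_inv_props assms by simp
qed

text \<open>The slope may blow up at \<open>0\<close>. The inverse itself has a limit there, being monotone and
  bounded below by \<open>0\<close>, and this suffices for the integrability of its nonnegative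
  derivative.\<close>

lemma inv_slope_integrable_if_invertible:
  assumes t: "t \<in> levels" shows "set_integrable lborel {0<..<t} inv_slope"
proof -
  have sub: "s \<in> levels" if "0 < s" "s \<le> t" for s
    using that t le_less_trans[of "ereal s" "ereal t" \<eta>] by (auto simp: einterval_iff)
  have "continuous_on levels (\<lambda>s. 1 / q (branch_inv s))"
  proof (intro continuous_on_divide continuous_on_const)
    have "continuous_on levels branch_inv"
      using DERIV_branch_inv DERIV_isCont by (intro continuous_at_imp_continuous_on) blast
    then show "continuous_on levels (\<lambda>s. q (branch_inv s))"
      using branch_inv_props(4) by (intro continuous_on_compose2[OF cont_deriv]) auto
    show "\<forall>s\<in>levels. q (branch_inv s) \<noteq> 0"
      using branch_inv_props slope_pos by (force simp: einterval_iff)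
  qed
  then have cont_slope: "continuous_on levels inv_slope"
    by (rule continuous_on_eq) (simp add: inv_slope_eq)
  have F: "(branch_inv has_real_derivative inv_slope s) (at s)" if "s \<in> levels" for s
    using DERIV_branch_inv[OF that] inv_slope_eq[OF that] by simp
  have "(branch_inv \<longlongrightarrow> Inf (branch_inv ` ({0<..} \<inter> {..t}))) (at 0 within ({0<..} \<inter> {..t}))"
  proof (rule Lim_right_bound)
    show "branch_inv u \<le> branch_inv v" if "u \<in> {..t}" "v \<in> {..t}" "0 < u" "u \<le> v" for u v
      using that sub by (intro branch_inv_mono) auto
    show "0 \<le> branch_inv u" if "u \<in> {..t}" "0 < u" for u
      using that sub branch_inv_props(3)[of u] by auto
  qed
  also have "at 0 within ({0<..} \<inter> {..t}) = at_right 0"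
    using t by (intro at_within_nhd[of _ "{..<t}"]) (auto simp: einterval_iff)
  finally have lim0: "(branch_inv \<longlongrightarrow> Inf (branch_inv ` ({0<..} \<inter> {..t}))) (at_right 0)" .
  have limt: "(branch_inv \<longlongrightarrow> branch_inv t) (at_left t)"
    using DERIV_isCont[OF F[OF t]] unfolding isCont_def by (rule tendsto_within_subset) simp
  have inS: "u \<in> levels" if "ereal 0 < ereal u" "ereal u < ereal t" for u
    using sub that by auto
  have "set_integrable lborel (einterval (ereal 0) (ereal t)) inv_slope"
  proof (rule interval_integral_FTC_nonneg(1)[where F = branch_inv])
    show "ereal 0 < ereal t"
      using t by (simp add: einterval_iff)
    show "isCont inv_slope u" if "ereal 0 < ereal u" "ereal u < ereal t" for u
      using cont_slope inS[OF that] by (simp add: continuous_on_eq_continuous_at)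
    show "AE u in lborel. ereal 0 < ereal u \<longrightarrow> ereal u < ereal t \<longrightarrow> 0 \<le> inv_slope u"
    proof (intro AE_I2 impI)
      fix u assume u: "ereal 0 < ereal u" "ereal u < ereal t"
      have "0 < q (branch_inv u)"
        using branch_inv_props[OF inS[OF u]] u by (intro slope_pos) auto
      then show "0 \<le> inv_slope u"
        using inv_slope_eq[OF inS[OF u]] by simp
    qed
    show "((branch_inv \<circ> real_of_ereal) \<longlongrightarrow> Inf (branch_inv ` ({0<..} \<inter> {..t}))) (at_right (ereal 0))"
      using lim0 by (simp only: ereal_tendsto_simps1)
    show "((branch_inv \<circ> real_of_ereal) \<longlongrightarrow> branch_inv t) (at_left (ereal t))"
      using limt by (simp only: ereal_tendsto_simps1)
    show "(branch_inv has_real_derivative inv_slope u) (at u)"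
      if "ereal 0 < ereal u" "ereal u < ereal t" for u
      using inS[OF that] by (rule F)
  qed
  then show ?thesis by simp
qed

end

lemma inv_slope_nonneg: assumes "0 < s" "ereal s < \<eta>" shows "0 \<le> inv_slope s"
proof (cases "has_inverse_on levels D p")
  case True
  then show ?thesis
    using inv_slope_eq[OF True, of s] branch_inv_props[OF True, of s] slope_pos[of "branch_inv s"] assms
    by (auto simp: einterval_iff zero_ereal_def)
qed (simp add: inv_slope_def)

lemma inv_slope_integrable:
  assumes "0 < t" "ereal t < \<eta>" shows "set_integrable lborel {0<..<t} inv_slope"
proof (cases "has_inverse_on levels D p")
  case True
  then show ?thesis
    using inv_slope_integrable_if_invertible assms by (auto simp: einterval_iff zero_ereal_def)
next
  case False
  then have "inv_slope = (\<lambda>_. 0)" by (auto simp: inv_slope_def)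
  then show ?thesis by (simp add: set_integrable_def)
qed

text \<open>The derivative \<open>q\<close> is smallest at the lowest admissible point, the one at level exactly
  \<open>s\<close>, so the supremum of the reciprocals is attained there. Without an inverse the branch never
  rises above \<open>0\<close>, and both sides are \<open>0\<close>.\<close>

lemma inv_slope_eq_Sup:
  assumes s: "0 < s" "ereal s < \<eta>"
  shows "ennreal (inv_slope s) = (SUP x\<in>{x \<in> D. s \<le> p x \<and> ereal (p x) < \<eta>}. 1 / ennreal \<bar>q x\<bar>)"
proof (cases "has_inverse_on levels D p")
  case True
  have sS: "s \<in> levels"
    using s by (simp add: einterval_iff zero_ereal_def)
  note i = branch_inv_props[OF True sS]
  have recip: "1 / ennreal \<bar>q x\<bar> = ennreal (1 / q x)" if "x \<in> D" "s \<le> p x" for x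
    using slope_pos[of x] that s divide_ennreal[of 1 "q x"] by simp
  show ?thesis
  proof (rule antisym)
    show "ennreal (inv_slope s) \<le> (SUP x\<in>{x \<in> D. s \<le> p x \<and> ereal (p x) < \<eta>}. 1 / ennreal \<bar>q x\<bar>)"
      using i s recip[of "branch_inv s"] inv_slope_eq[OF True sS]
      by (intro SUP_upper2[of "branch_inv s"]) auto
    show "(SUP x\<in>{x \<in> D. s \<le> p x \<and> ereal (p x) < \<eta>}. 1 / ennreal \<bar>q x\<bar>) \<le> ennreal (inv_slope s)"
    proof (rule SUP_least)
      fix x assume "x \<in> {x \<in> D. s \<le> p x \<and> ereal (p x) < \<eta>}"
      then have x: "x \<in> D" "s \<le> p x" by auto
      have "branch_inv s \<le> x"
        using strict_mono_pos[of x "branch_inv s"] x i s by (cases "branch_inv s \<le> x") auto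
      then have "q (branch_inv s) \<le> q x"
        using slope_mono[of "branch_inv s" x] i x s by simp
      moreover have "0 < q (branch_inv s)"
        using slope_pos[of "branch_inv s"] i s by simp
      ultimately have "1 / q x \<le> 1 / q (branch_inv s)"
        by (intro divide_left_mono) auto
      then show "1 / ennreal \<bar>q x\<bar> \<le> ennreal (inv_slope s)"
        using recip[OF x] inv_slope_eq[OF True sS] by (simp add: ennreal_leI)
    qed
  qed
next
  case False
  then have "{x \<in> D. s \<le> p x \<and> ereal (p x) < \<eta>} = {}"
    using has_inverseI s(1) by (auto intro: less_le_trans)
  then show ?thesis
    using False unfolding inv_slope_def
    by (simp only: if_False image_empty Sup_empty bot_ennreal ennreal_0)
qed

end

section \<open>The two branches at a point\<close>

text \<open>The parameter \<open>\<sigma>\<close> is \<open>1\<close> for the branch to the right of \<open>x0\<close> and \<open>- 1\<close> for the branch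
  to the left; it is its own inverse, so \<open>y \<mapsto> \<sigma> (y - x0)\<close> undoes the parametrisation of
  the ray.\<close>

lemma convex_branch_along_ray:
  fixes g g' :: "real \<Rightarrow> real"
  assumes I: "open I" "is_interval I" and x0: "x0 \<in> I" and conv: "convex_on I g"
    and deriv: "\<And>x. x \<in> I - {x0} \<Longrightarrow> (g has_real_derivative g' x) (at x)"
    and cont: "continuous_on (I - {x0}) g'" and \<sigma>: "\<bar>\<sigma>\<bar> = 1"
    and reach: "\<And>x s. x \<in> I \<Longrightarrow> 0 \<le> \<sigma> * (x - x0) \<Longrightarrow> g x0 < g x \<Longrightarrow> 0 < s \<Longrightarrow> ereal s < \<eta>
      \<Longrightarrow> \<exists>y\<in>I. 0 \<le> \<sigma> * (y - x0) \<and> g x0 + s \<le> g y"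
  shows "convex_branch (\<lambda>y. g (x0 + \<sigma> * y) - g x0) (\<lambda>y. \<sigma> * g' (x0 + \<sigma> * y))
    {y. 0 \<le> y \<and> x0 + \<sigma> * y \<in> I} \<eta>"
proof -
  let ?D = "{y. 0 \<le> y \<and> x0 + \<sigma> * y \<in> I}"
  have \<sigma>2: "\<sigma> * (\<sigma> * z) = z" for z
    using \<sigma> by (auto simp: abs_if split: if_splits)
  have \<sigma>0: "\<sigma> \<noteq> 0"
    using \<sigma> by auto
  have D0: "?D - {0} = {0<..} \<inter> (\<lambda>y. x0 + \<sigma> * y) -` I"
    using x0 by auto
  have D0I: "x0 + \<sigma> * y \<in> I - {x0}" if "y \<in> ?D - {0}" for y
    using that \<sigma>0 by auto
  have contg: "continuous_on I g"
    using I(1) conv by (rule convex_on_continuous)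
  show ?thesis
  proof
    show "is_interval ?D"
      unfolding is_interval_1
    proof (intro ballI allI impI)
      fix u v w assume *: "u \<in> ?D" "v \<in> ?D" "u \<le> w \<and> w \<le> v"
      from \<sigma> consider "\<sigma> = 1" | "\<sigma> = -1"
        by linarith
      then have "x0 + \<sigma> * w \<in> I"
        by cases (use * in \<open>auto intro: mem_is_interval_1_I[OF I(2), of "x0 + u" "x0 + v"]
            mem_is_interval_1_I[OF I(2), of "x0 - v" "x0 - u"]\<close>)
      with * show "w \<in> ?D" by auto
    qed
    show "open (?D - {0})"
      unfolding D0 using I(1) by (intro open_Int open_vimage continuous_intros) auto
    show "continuous_on ?D (\<lambda>y. g (x0 + \<sigma> * y) - g x0)"
      by (intro continuous_intros continuous_on_compose2[OF contg]) auto
    show "continuous_on (?D - {0}) (\<lambda>y. \<sigma> * g' (x0 + \<sigma> * y))"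
      using \<sigma>0 by (intro continuous_intros continuous_on_compose2[OF cont]) auto
    fix x assume x: "x \<in> ?D - {0}"
    have "((\<lambda>y. g (x0 + \<sigma> * y)) has_real_derivative g' (x0 + \<sigma> * x) * \<sigma>) (at x)"
      by (rule DERIV_chain2[where f = g and g = "\<lambda>y. x0 + \<sigma> * y", OF deriv[OF D0I[OF x]]])
        (auto intro!: derivative_eq_intros)
    then show "((\<lambda>y. g (x0 + \<sigma> * y) - g x0) has_real_derivative \<sigma> * g' (x0 + \<sigma> * x)) (at x)"
      by (auto intro!: derivative_eq_intros)
    fix y assume y: "y \<in> ?D"
    have "g (x0 + \<sigma> * y) - g (x0 + \<sigma> * x) \<ge> g' (x0 + \<sigma> * x) * ((x0 + \<sigma> * y) - (x0 + \<sigma> * x))"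
      using conv is_interval_connected[OF I(2)] D0I[OF x] y I(1)
      by (intro convex_on_imp_above_tangent[where A = I] has_field_derivative_at_within[OF deriv])
        (auto simp: interior_open)
    then show "g (x0 + \<sigma> * x) - g x0 + \<sigma> * g' (x0 + \<sigma> * x) * (y - x) \<le> g (x0 + \<sigma> * y) - g x0"
      by (simp add: algebra_simps)
  next
    fix x s assume "x \<in> ?D" "0 < g (x0 + \<sigma> * x) - g x0" "0 < s" "ereal s < \<eta>"
    then obtain y where y: "y \<in> I" "0 \<le> \<sigma> * (y - x0)" "g x0 + s \<le> g y"
      using reach[of "x0 + \<sigma> * x" s] by (auto simp: \<sigma>2)
    then show "\<exists>y\<in>?D. s \<le> g (x0 + \<sigma> * y) - g x0"
      by (intro bexI[of _ "\<sigma> * (y - x0)"]) (auto simp: \<sigma>2)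
  qed (simp_all add: x0)
qed

text \<open>Where \<open>g\<close> exceeds \<open>g x0\<close> its tangent points upwards in the direction \<open>\<sigma>\<close>, and
  \<open>g\<close> stays above this line along the whole ray.\<close>

lemma reach_on_unbounded_ray:
  fixes g :: "real \<Rightarrow> real"
  assumes I: "open I" "is_interval I" and x0: "x0 \<in> I" and conv: "convex_on I g"
    and deriv: "(g has_real_derivative m) (at x)"
    and \<sigma>: "\<bar>\<sigma>\<bar> = 1" and ray: "\<And>y. 0 \<le> \<sigma> * (y - x0) \<Longrightarrow> y \<in> I"
    and x: "0 \<le> \<sigma> * (x - x0)" "g x0 < g x" and s: "0 < s"
  shows "\<exists>y\<in>I. 0 \<le> \<sigma> * (y - x0) \<and> g x0 + s \<le> g y"
proof -
  have tangent: "g x + m * (y - x) \<le> g y" if "y \<in> I" for y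
    using convex_on_imp_above_tangent[OF conv is_interval_connected[OF I(2)] _ that
        has_field_derivative_at_within[OF deriv]] ray[OF x(1)] I(1)
    by (simp add: interior_open)
  have \<sigma>2: "\<sigma> * (\<sigma> * z) = z" for z
    using \<sigma> by (auto simp: abs_if split: if_splits)
  have "0 < m * (x - x0)"
    using tangent[OF x0] x(2) by (simp add: algebra_simps)
  also have "m * (x - x0) = (\<sigma> * m) * (\<sigma> * (x - x0))"
    by (metis \<sigma>2 mult.assoc mult.left_commute)
  finally have pos: "0 < \<sigma> * m"
    using x(1) by (metis zero_less_mult_pos2 less_le mult_zero_right)
  define y where "y = x + \<sigma> * (s / (\<sigma> * m))"
  have "\<sigma> * (y - x0) = \<sigma> * (x - x0) + s / (\<sigma> * m)"
    using \<sigma>2[of "s / (\<sigma> * m)"] by (simp add: y_def algebra_simps)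
  then have side: "0 \<le> \<sigma> * (y - x0)"
    using x(1) s pos by simp
  have "m * (y - x) = s"
    using pos by (auto simp: y_def)
  then show ?thesis
    using tangent[OF ray[OF side]] x(2) side ray[OF side] by (intro bexI[of _ y]) auto
qed

text \<open>The filter \<open>F\<close> selects the side from which the endpoint \<open>e\<close> is approached. The function may
  jump down at \<open>e\<close>, but not up, so its values near \<open>e\<close> exceed every level below
  \<open>f e\<close>.\<close>

lemma lower_semicont_exceeds:
  assumes "lower_semicont f" "l < f e" "F \<le> at e" "F \<noteq> bot" "eventually P F"
  shows "\<exists>y. P y \<and> l < f y"
proof -
  have "eventually (\<lambda>y. l < f y) (at e)"
    using assms(1,2) by (auto simp: lower_semicont_def le_Liminf_iff)
  then have "eventually (\<lambda>y. P y \<and> l < f y) F"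
    using assms(3,5) by (auto intro: eventually_conj filter_leD)
  then show ?thesis
    using assms(4) eventually_happens by blast
qed

section \<open>The exact modulus\<close>

theorem proposition3p11:
  fixes f :: "real \<Rightarrow> ereal" and xbar :: real and a b \<eta> :: ereal
    and f1 f2 :: "real \<Rightarrow> real" and D1 D2 :: "real set" and \<phi> :: "real \<Rightarrow> real"
  assumes "proper_fun f" and "lower_semicont f"
    and "0 \<in> limiting_subdiff f xbar"
    and "a < b" and "einterval a b \<subseteq> interior (edom f)" and "xbar \<in> einterval a b"
    and "convex_on (einterval a b) (\<lambda>x. real_of_ereal (f x))"
    and "(\<lambda>x. real_of_ereal (f x)) C1_differentiable_on (einterval a b - {xbar})"
    and "\<eta> = min (at_ext f a - f xbar) (at_ext f b - f xbar)" and "0 < \<eta>"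
    and "D1 = {x. a - ereal xbar < ereal x \<and> x \<le> 0}"
    and "D2 = {x. 0 \<le> x \<and> ereal x < b - ereal xbar}"
    and "\<And>x. x \<in> D1 \<Longrightarrow> f1 x = real_of_ereal (f (x + xbar) - f xbar)"
    and "\<And>x. x \<in> D2 \<Longrightarrow> f2 x = real_of_ereal (f (x + xbar) - f xbar)"
    and "\<phi> 0 = 0"
    and "\<And>t. 0 < t \<Longrightarrow> ereal t < \<eta> \<Longrightarrow>
      \<phi> t = (LBINT s:{0<..<t}.
        max (if has_inverse_on (einterval 0 \<eta>) D1 f1
             then deriv (\<lambda>u. - inverse_on (einterval 0 \<eta>) D1 f1 u) s else 0)
            (if has_inverse_on (einterval 0 \<eta>) D2 f2
             then deriv (inverse_on (einterval 0 \<eta>) D2 f2) s else 0))"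
  shows "is_exact_modulus f xbar (einterval a b) \<eta> \<phi>"
proof -
  define I where "I = einterval a b"
  define g where "g = (\<lambda>x. real_of_ereal (f x))"
  have I: "open I" and x0: "xbar \<in> I"
    using assms(6) by (auto simp: I_def)
  have "w \<in> I" if "u \<in> I" "v \<in> I" "u \<le> w" "w \<le> v" for u v w
    using that less_le_trans[of a "ereal u" "ereal w"] le_less_trans[of "ereal w" "ereal v" b]
    by (auto simp: I_def einterval_iff)
  then have I: "open I" "is_interval I"
    using I unfolding is_interval_1 by blast+
  have Idom: "I \<subseteq> edom f"
    using assms(5) interior_subset by (auto simp: I_def)
  have proper: "f x \<noteq> -\<infinity>" for x
    using assms(1) by (auto simp: proper_fun_def)
  have fin: "f x = ereal (g x)" if "x \<in> I" for x
    using that Idom proper[of x] by (cases "f x") (auto simp: edom_def g_def)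
  have conv: "convex_on I g"
    using assms(7) by (simp add: I_def g_def)
  obtain g' where deriv: "\<And>x. x \<in> I - {xbar} \<Longrightarrow> (g has_real_derivative g' x) (at x)"
    and cont: "continuous_on (I - {xbar}) g'"
    using assms(8) by (auto simp: C1_differentiable_on_def has_real_derivative_iff_has_vector_derivative
        I_def g_def)
  have subdiff: "limiting_subdiff f x = {g' x}" if "x \<in> I" "x \<noteq> xbar" for x
    using limiting_subdiff_eq_deriv[OF proper I(1) Idom _ that(1), of "g' x"] conv deriv that
    by (simp add: g_def)

  \<comment> \<open>By the choice of \<open>\<eta>\<close>, every level below \<open>\<eta>\<close> is exceeded at each finite endpoint.\<close>
  have beyond: "ereal (g xbar + s) < f (real_of_ereal e)"
    if "ereal s < \<eta>" "\<bar>e\<bar> \<noteq> \<infinity>" "e = a \<or> e = b" for s e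
  proof -
    have "ereal s < f (real_of_ereal e) - ereal (g xbar)"
      using that fin[OF x0] assms(9) by (auto simp: at_ext_def)
    then show ?thesis
      by (cases "f (real_of_ereal e)") auto
  qed
  have reach_right: "\<exists>y\<in>I. 0 \<le> 1 * (y - xbar) \<and> g xbar + s \<le> g y"
    if *: "x \<in> I" "0 \<le> 1 * (x - xbar)" "g xbar < g x" "0 < s" "ereal s < \<eta>" for x s
  proof (cases "b = \<infinity>")
    case True
    then have "y \<in> I" if "0 \<le> 1 * (y - xbar)" for y
      using x0 that by (auto simp: I_def einterval_iff intro: less_le_trans[of _ "ereal xbar"])
    then show ?thesis
      using reach_on_unbounded_ray[OF I x0 conv deriv, of x 1 s] * by fastforce
  next
    case False
    then obtain e where e: "b = ereal e"
      using assms(4) by (cases b) auto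
    have "xbar < e"
      using x0 by (auto simp: I_def einterval_iff e)
    then have "eventually (\<lambda>y. y \<in> {xbar<..<e}) (at_left e)"
      by (rule eventually_at_left_real)
    from lower_semicont_exceeds[OF assms(2) _ at_le[OF subset_UNIV] _ this] beyond[OF *(5), of b]
    obtain y where y: "xbar < y" "y < e" "ereal (g xbar + s) < f y"
      by (auto simp: e)
    then have "y \<in> I"
      using x0 by (auto simp: I_def einterval_iff e intro: less_trans[of _ "ereal xbar"])
    then show ?thesis
      using y fin[of y] by (intro bexI[of _ y]) auto
  qed
  have reach_left: "\<exists>y\<in>I. 0 \<le> - 1 * (y - xbar) \<and> g xbar + s \<le> g y"
    if *: "x \<in> I" "0 \<le> - 1 * (x - xbar)" "g xbar < g x" "0 < s" "ereal s < \<eta>" for x s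
  proof (cases "a = - \<infinity>")
    case True
    then have "y \<in> I" if "0 \<le> - 1 * (y - xbar)" for y
      using x0 that by (auto simp: I_def einterval_iff intro: le_less_trans[of _ "ereal xbar"])
    then show ?thesis
      using reach_on_unbounded_ray[OF I x0 conv deriv, of x "-1" s] * by fastforce
  next
    case False
    then obtain e where e: "a = ereal e"
      using assms(4) by (cases a) auto
    have "e < xbar"
      using x0 by (auto simp: I_def einterval_iff e)
    then have "eventually (\<lambda>y. y \<in> {e<..<xbar}) (at_right e)"
      by (rule eventually_at_right_real)
    from lower_semicont_exceeds[OF assms(2) _ at_le[OF subset_UNIV] _ this] beyond[OF *(5), of a]
    obtain y where y: "e < y" "y < xbar" "ereal (g xbar + s) < f y"
      by (auto simp: e)
    then have "y \<in> I"
      using x0 by (auto simp: I_def einterval_iff e intro: less_trans[of _ "ereal xbar"])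
    then show ?thesis
      using y fin[of y] by (intro bexI[of _ y]) auto
  qed

  \<comment> \<open>The factors \<open>1\<close> and \<open>- 1\<close> are the values of \<open>\<sigma>\<close>, kept unevaluated so that both
    branches match \<open>convex_branch_along_ray\<close> syntactically.\<close>
  define Dr where "Dr = {y. 0 \<le> y \<and> xbar + 1 * y \<in> I}"
  define Dl where "Dl = {y. 0 \<le> y \<and> xbar + - 1 * y \<in> I}"
  define pr where "pr = (\<lambda>y. g (xbar + 1 * y) - g xbar)"
  define pl where "pl = (\<lambda>y. g (xbar + - 1 * y) - g xbar)"
  interpret r: convex_branch pr "\<lambda>y. 1 * g' (xbar + 1 * y)" Dr \<eta>
    unfolding pr_def Dr_def
    by (rule convex_branch_along_ray[OF I x0 conv deriv cont _ reach_right]) auto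
  interpret l: convex_branch pl "\<lambda>y. - 1 * g' (xbar + - 1 * y)" Dl \<eta>
    unfolding pl_def Dl_def
    by (rule convex_branch_along_ray[OF I x0 conv deriv cont _ reach_left]) auto

  let ?S = "einterval 0 \<eta>"
  have D2: "D2 = Dr"
  proof -
    have "ereal y < b - ereal xbar \<longleftrightarrow> xbar + y \<in> I" if "0 \<le> y" for y
      using that x0 unfolding I_def einterval_iff
      by (cases a; cases b) auto
    then show ?thesis
      by (auto simp: assms(12) Dr_def)
  qed
  have D1: "D1 = uminus ` Dl"
  proof -
    have "a - ereal xbar < ereal y \<longleftrightarrow> xbar + y \<in> I" if "y \<le> 0" for y
      using that x0 unfolding I_def einterval_iff
      by (cases a; cases b) auto
    then have "y \<in> D1 \<longleftrightarrow> - y \<in> Dl" for y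
      by (auto simp: assms(11) Dl_def)
    then show ?thesis
      unfolding set_eq_iff image_iff by (metis minus_minus)
  qed
  have f2: "f2 y = pr y" if "y \<in> Dr" for y
    using that assms(14)[of y] D2 fin[OF x0] fin[of "xbar + y"]
    by (auto simp: pr_def Dr_def add.commute)
  have f1: "f1 y = pl (- y)" if "y \<in> uminus ` Dl" for y
    using that assms(13)[of y] D1 fin[OF x0] fin[of "xbar + y"]
    by (auto simp: pl_def Dl_def add.commute)
  have right: "(if has_inverse_on ?S D2 f2 then deriv (inverse_on ?S D2 f2) s else 0) = r.inv_slope s" for s
    using inverse_on_cong[of Dr f2 pr ?S] f2 by (simp add: r.inv_slope_def r.branch_inv_def D2)
  have left: "(if has_inverse_on ?S D1 f1 then deriv (\<lambda>u. - inverse_on ?S D1 f1 u) s else 0) = l.inv_slope s"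
    if "s \<in> ?S" for s
    using inverse_on_cong[of "uminus ` Dl" f1 "\<lambda>y. pl (- y)" ?S] f1
      has_inverse_on_reflect[of ?S Dl pl] deriv_inverse_on_reflect[OF _ that, of Dl pl]
    by (simp add: l.inv_slope_def l.branch_inv_def D1)

  \<comment> \<open>The points admitted in the supremum split into those left and those right of \<open>xbar\<close>, and
    each half is the supremum already computed for its branch.\<close>
  have KL: "KL_slope_sup f xbar I \<eta> s = ennreal (max (l.inv_slope s) (r.inv_slope s))"
    if s: "0 < s" "ereal s < \<eta>" for s
  proof -
    let ?A = "{x \<in> I. s \<le> g x - g xbar \<and> ereal (g x - g xbar) < \<eta>}"
    let ?R = "{y \<in> Dr. s \<le> pr y \<and> ereal (pr y) < \<eta>}"
    let ?L = "{y \<in> Dl. s \<le> pl y \<and> ereal (pl y) < \<eta>}"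
    have "KL_slope_sup f xbar I \<eta> s = (SUP x\<in>?A. 1 / ennreal \<bar>g' x\<bar>)"
      unfolding KL_slope_sup_def
    proof (rule SUP_cong)
      show "{x \<in> I. 0 < f x - f xbar \<and> f x - f xbar < \<eta> \<and> ereal s \<le> f x - f xbar} = ?A"
        using s fin x0 by (auto simp: zero_ereal_def)
      fix x assume x: "x \<in> ?A"
      then have "x \<noteq> xbar"
        using s by auto
      with x show "1 / dist_zero (limiting_subdiff f x) = 1 / ennreal \<bar>g' x\<bar>"
        by (simp add: subdiff dist_zero_def)
    qed
    also have "?A = (\<lambda>y. xbar + - 1 * y) ` ?L \<union> (\<lambda>y. xbar + 1 * y) ` ?R"
    proof (intro equalityI subsetI)
      fix x assume x: "x \<in> ?A"
      show "x \<in> (\<lambda>y. xbar + - 1 * y) ` ?L \<union> (\<lambda>y. xbar + 1 * y) ` ?R"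
      proof (cases "x \<le> xbar")
        case True
        then have "x = xbar + - 1 * (xbar - x)" "xbar - x \<in> ?L"
          using x by (auto simp: Dl_def pl_def)
        then show ?thesis by blast
      next
        case False
        then have "x = xbar + 1 * (x - xbar)" "x - xbar \<in> ?R"
          using x by (auto simp: Dr_def pr_def)
        then show ?thesis by blast
      qed
    qed (auto simp: Dl_def Dr_def pl_def pr_def)
    also have "(SUP x\<in>\<dots>. 1 / ennreal \<bar>g' x\<bar>) = sup (ennreal (l.inv_slope s)) (ennreal (r.inv_slope s))"
      using l.inv_slope_eq_Sup[OF s] r.inv_slope_eq_Sup[OF s] by (simp add: SUP_union image_image)
    also have "\<dots> = ennreal (max (l.inv_slope s) (r.inv_slope s))"
      using l.inv_slope_nonneg[OF s] r.inv_slope_nonneg[OF s] by (auto simp: sup_max max_def)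
    finally show ?thesis .
  qed

  have \<phi>: "0 \<le> \<phi> t \<and> ennreal (\<phi> t) = (\<integral>\<^sup>+ s\<in>{0<..<t}. KL_slope_sup f xbar I \<eta> s \<partial>lborel)"
    if t: "0 < t" "ereal t < \<eta>" for t
  proof -
    let ?h = "\<lambda>s. max (l.inv_slope s) (r.inv_slope s)"
    have st: "0 < s \<and> ereal s < \<eta>" if "s \<in> {0<..<t}" for s
      using that t(2) less_trans[of "ereal s" "ereal t" \<eta>] by auto
    have "\<phi> t = (LBINT s:{0<..<t}. ?h s)"
      unfolding assms(16)[OF t] right
      by (intro set_lebesgue_integral_cong) (use st left in \<open>auto simp: einterval_iff zero_ereal_def\<close>)
    also have "\<dots> = (\<integral>s. ?h s * indicator {0<..<t} s \<partial>lborel)"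
      by (simp add: set_lebesgue_integral_def mult.commute)
    finally have \<phi>t: "\<phi> t = (\<integral>s. ?h s * indicator {0<..<t} s \<partial>lborel)" .
    have nonneg: "0 \<le> ?h s * indicator {0<..<t} s" for s
      using st[of s] l.inv_slope_nonneg[of s] by (auto simp: indicator_def max_def)
    have eq: "?h s * indicator {0<..<t} s
      = max (indicator {0<..<t} s *\<^sub>R l.inv_slope s) (indicator {0<..<t} s *\<^sub>R r.inv_slope s)" for s
      by (auto simp: indicator_def)
    have int: "integrable lborel (\<lambda>s. ?h s * indicator {0<..<t} s)"
      unfolding eq using l.inv_slope_integrable[OF t] r.inv_slope_integrable[OF t]
      by (intro integrable_max) (auto simp: set_integrable_def)
    have "(\<integral>\<^sup>+ s\<in>{0<..<t}. KL_slope_sup f xbar I \<eta> s \<partial>lborel)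
      = (\<integral>\<^sup>+ s. ennreal (?h s * indicator {0<..<t} s) \<partial>lborel)"
      using KL st by (intro nn_integral_cong) (auto simp: indicator_def)
    also have "\<dots> = ennreal (\<phi> t)"
      unfolding \<phi>t using int nonneg by (intro nn_integral_eq_integral) auto
    finally show ?thesis
      using nonneg unfolding \<phi>t by (auto intro: integral_nonneg)
  qed
  \<comment> \<open>If no level in \<open>(0, \<eta>)\<close> is attained, the supremum is empty and the integral formula
    already forces the value \<open>0\<close>.\<close>
  have \<phi>_zero: "\<phi> t = 0"
    if none: "\<not> (\<exists>x\<in>I. 0 < f x - f xbar \<and> f x - f xbar < \<eta>)" and t: "0 < t" "ereal t < \<eta>" for t
  proof -
    have "KL_slope_sup f xbar I \<eta> s = 0" for s
    proof -
      have empty: "{x \<in> I. 0 < f x - f xbar \<and> f x - f xbar < \<eta> \<and> ereal s \<le> f x - f xbar} = {}"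
        using none by auto
      show ?thesis
        unfolding KL_slope_sup_def empty by (simp only: image_empty Sup_empty bot_ennreal)
    qed
    then show ?thesis
      using \<phi>[OF t] by (simp add: ennreal_eq_0_iff)
  qed
  have dom: "I \<subseteq> dom_subdiff f" "xbar \<in> dom_subdiff f"
    using subdiff assms(3) by (auto simp: dom_subdiff_def)
  have finite: "KL_slope_sup f xbar I \<eta> s < \<infinity>" if "0 < s" "ereal s < \<eta>" for s
    using KL[OF that] by simp
  have int: "xbar \<in> interior I"
    using I(1) x0 by (simp add: interior_open)
  show ?thesis
  proof (cases "\<exists>x\<in>I. 0 < f x - f xbar \<and> f x - f xbar < \<eta>")
    case True
    show ?thesis
      unfolding is_exact_modulus_def I_def[symmetric] if_P[OF True]
      by (intro conjI allI impI dom int assms(10,15)) (blast dest: finite \<phi>)+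
  next
    case False
    show ?thesis
      unfolding is_exact_modulus_def I_def[symmetric] if_not_P[OF False]
      by (intro conjI allI impI dom int assms(10,15)) (blast dest: finite \<phi>_zero[OF False])+
  qed
qed

end
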